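(* The optimal policy has a bang-bang structure (that is, the optimal production rate in every state $(x,t)$ can be taken in $\{0,\bar s\}$) if any of the following conditions is satisfied: (i) $r(s)=f(s)$ for all $s\in\mathscr{S}$; (ii) $r(s)=a\cdot s^{\alpha}$ and $f(s)=b\cdot s^{\beta}$ with constants $\alpha\ge\beta$, $a$, and $b$; (iii) $r(\cdot)$ is convex and $f(\cdot)$ is concave.
   Context: "Increasing" and "decreasing" are meant in the weak sense throughout. Model. A system has deterioration level in $\mathscr{X}=\{0,1,\ldots,\xi\}$, where $\xi\in\mathbb{N}$ is the failure level. The decision maker continuously chooses a production rate $s\in\mathscr{S}=[0,\bar s]$, $0<\bar s<\infty$. Under rate $s$, revenue accrues at rate $r(s)$ and the deterioration level jumps up by one according to a Poisson process with instantaneous intensity $\lambda f(s)$, where $\lambda\ge 0$ is the base rate. The deterioration function $f:\mathscr{S}\to\mathbb{R}_+$ and the revenue function $r:\mathscr{S}\to\mathbb{R}$ are continuous and increasing, with $f(0)=0$ and $r(0)\le 0$ (these assumptions are in force in each of the three cases). The maintenance cost function $c_m:\mathscr{X}\to\mathbb{R}_+$ is increasing and convex. Time is indexed backwards: $t$ denotes the remaining time to the planned maintenance moment, which occurs at $t=0$, and $X_k$ is the deterioration level when $k$ time units remain. $\mathscr{U}$ is the set of non-anticipating production policies under which, almost surely, the deterioration level never exceeds $\xi$; in particular, the system is turned off ($s=0$) once it has reached level $\xi$. For $u\in\mathscr{U}$, with induced production rate $s^u_\lambda(x,k)$ at level $x$ and remaining time $k$, $$J^u_\lambda(x,t)=\mathbb{E}_u\Big[\int_0^t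 r\big(s^u_\lambda(X_k,k)\big)\,dk-c_m(X_0)\ \Big|\ X_t=x\Big],\qquad J^*_\lambda(x,t)=\sup_{u\in\mathscr{U}}J^u_\lambda(x,t).$$ Write $\Delta_\lambda(x,t)=J^*_\lambda(x,t)-J^*_\lambda(x+1,t)$ for $x\in\{0,\ldots,\xi-1\}$. The optimal production rate in state $(x,t)$ is, for $x\le\xi-1$, a solution of $\max_{s\in\mathscr{S}}\big[r(s)-\lambda f(s)\Delta_\lambda(x,t)\big]$, and is $0$ for $x=\xi$. A bang-bang production policy is a policy in which production is always either set to the maximum rate $s=\bar s$ or turned off, $s=0$. *)

theory Defs
  imports "HOL-Probability.Probability"
begin

text \<open>
  Time is remaining time, so it runs downwards from the initial \<open>t\<close> to \<open>0\<close>.  The level path is a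
  step function; what has been observed of it is the list of the levels visited so far, each with
  the remaining time at which it was entered, oldest first.  A non-anticipating policy chooses the
  rate at remaining time \<open>k\<close> from the history up to \<open>k\<close> (and from \<open>k\<close> itself).  A feedback rule
  \<open>s x k\<close> is the special case \<open>\<lambda>h k. s (fst (last h)) k\<close>.
\<close>

type_synonym history = "(nat \<times> real) list"

type_synonym policy = "history \<Rightarrow> real \<Rightarrow> real"

text \<open>
  The controlled jump process is driven by independent unit exponential variables: if \<open>h\<close> is the
  history just after a jump at remaining time \<open>\<tau>\<close>, the next jump occurs as soon as the intensity
  \<open>lam * f (u h v)\<close>, accumulated from \<open>\<tau>\<close> downwards, reaches the next exponential variable \<open>e\<close>.
  Hence, given \<open>h\<close>, there is no jump in \<open>[k, \<tau>]\<close> with probability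
  \<open>exp (- (\<integral>v\<in>[k, \<tau>]. lam * f (u h v)))\<close>.  If there is no further jump before the planned
  maintenance, the jump time is set to \<open>-1\<close>.
\<close>

definition noise :: "(nat \<Rightarrow> real) measure" where
  "noise = PiM UNIV (\<lambda>_. density lborel (\<lambda>e. ennreal (exponential_density 1 e)))"

definition next_jump :: "real \<Rightarrow> (real \<Rightarrow> real) \<Rightarrow> policy \<Rightarrow> history \<Rightarrow> real \<Rightarrow> real" where
  "next_jump lam f u h e =
     (let \<tau> = snd (last h);
          A = {k \<in> {0..\<tau>}. e \<le> (LINT v:{k..\<tau>}|lborel. lam * f (u h v))}
      in if A = {} then -1 else Sup A)"

primrec hist_after ::
  "real \<Rightarrow> (real \<Rightarrow> real) \<Rightarrow> policy \<Rightarrow> nat \<Rightarrow> real \<Rightarrow> (nat \<Rightarrow> real) \<Rightarrow> nat \<Rightarrow> history" where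
  "hist_after lam f u x t \<omega> 0 = [(x, t)]"
| "hist_after lam f u x t \<omega> (Suc n) =
     (let h = hist_after lam f u x t \<omega> n
      in h @ [(Suc (fst (last h)), next_jump lam f u h (\<omega> n))])"

definition jumps_until ::
  "real \<Rightarrow> (real \<Rightarrow> real) \<Rightarrow> policy \<Rightarrow> nat \<Rightarrow> real \<Rightarrow> (nat \<Rightarrow> real) \<Rightarrow> real \<Rightarrow> nat" where
  "jumps_until lam f u x t \<omega> k = card {n. k \<le> snd (last (hist_after lam f u x t \<omega> (Suc n)))}"

definition hist_at ::
  "real \<Rightarrow> (real \<Rightarrow> real) \<Rightarrow> policy \<Rightarrow> nat \<Rightarrow> real \<Rightarrow> (nat \<Rightarrow> real) \<Rightarrow> real \<Rightarrow> history" where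
  "hist_at lam f u x t \<omega> k = hist_after lam f u x t \<omega> (jumps_until lam f u x t \<omega> k)"

definition level_at ::
  "real \<Rightarrow> (real \<Rightarrow> real) \<Rightarrow> policy \<Rightarrow> nat \<Rightarrow> real \<Rightarrow> (nat \<Rightarrow> real) \<Rightarrow> real \<Rightarrow> nat" where
  "level_at lam f u x t \<omega> k = fst (last (hist_at lam f u x t \<omega> k))"

definition rate_at ::
  "real \<Rightarrow> (real \<Rightarrow> real) \<Rightarrow> policy \<Rightarrow> nat \<Rightarrow> real \<Rightarrow> (nat \<Rightarrow> real) \<Rightarrow> real \<Rightarrow> real" where
  "rate_at lam f u x t \<omega> k = u (hist_at lam f u x t \<omega> k) k"

text \<open>
  Measurability is required along each sequence of consecutive levels, jointly in the entry times
  and the current time.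
\<close>

definition policies :: "nat \<Rightarrow> real \<Rightarrow> real \<Rightarrow> (real \<Rightarrow> real) \<Rightarrow> policy set" where
  "policies xi sbar lam f =
     {u. (\<forall>h k. u h k \<in> {0..sbar}) \<and>
         (\<forall>x n. (\<lambda>(\<tau>, k). u (map (\<lambda>i. (x + i, \<tau> i)) [0..<Suc n]) k)
                  \<in> borel_measurable (PiM {..n} (\<lambda>_. borel) \<Otimes>\<^sub>M borel)) \<and>
         (\<forall>h k. h \<noteq> [] \<and> fst (last h) = xi \<longrightarrow> u h k = 0) \<and>
         (\<forall>x\<le>xi. \<forall>t\<ge>0. AE \<omega> in noise. \<forall>k\<in>{0..t}. level_at lam f u x t \<omega> k \<le> xi)}"

definition J ::
  "real \<Rightarrow> (real \<Rightarrow> real) \<Rightarrow> (real \<Rightarrow> real) \<Rightarrow> (nat \<Rightarrow> real) \<Rightarrow> policy \<Rightarrow> nat \<Rightarrow> real \<Rightarrow> real" where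
  "J lam f r cm u x t =
     (LINT \<omega>|noise. (LINT k:{0..t}|lborel. r (rate_at lam f u x t \<omega> k))
                      - cm (level_at lam f u x t \<omega> 0))"

definition J_opt ::
  "nat \<Rightarrow> real \<Rightarrow> real \<Rightarrow> (real \<Rightarrow> real) \<Rightarrow> (real \<Rightarrow> real) \<Rightarrow> (nat \<Rightarrow> real) \<Rightarrow> nat \<Rightarrow> real \<Rightarrow> real" where
  "J_opt xi sbar lam f r cm x t = (SUP u\<in>policies xi sbar lam f. J lam f r cm u x t)"

definition Delta ::
  "nat \<Rightarrow> real \<Rightarrow> real \<Rightarrow> (real \<Rightarrow> real) \<Rightarrow> (real \<Rightarrow> real) \<Rightarrow> (nat \<Rightarrow> real) \<Rightarrow> nat \<Rightarrow> real \<Rightarrow> real" where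
  "Delta xi sbar lam f r cm x t = J_opt xi sbar lam f r cm x t - J_opt xi sbar lam f r cm (Suc x) t"

definition optimal_rate ::
  "nat \<Rightarrow> real \<Rightarrow> real \<Rightarrow> (real \<Rightarrow> real) \<Rightarrow> (real \<Rightarrow> real) \<Rightarrow> (nat \<Rightarrow> real)
     \<Rightarrow> nat \<Rightarrow> real \<Rightarrow> real \<Rightarrow> bool" where
  "optimal_rate xi sbar lam f r cm x t s \<longleftrightarrow>
     (if x < xi
      then is_arg_max (\<lambda>s. r s - lam * f s * Delta xi sbar lam f r cm x t) (\<lambda>s. s \<in> {0..sbar}) s
      else s = 0)"

definition optimal_feedback ::
  "nat \<Rightarrow> real \<Rightarrow> real \<Rightarrow> (real \<Rightarrow> real) \<Rightarrow> (real \<Rightarrow> real) \<Rightarrow> (nat \<Rightarrow> real)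
     \<Rightarrow> (nat \<Rightarrow> real \<Rightarrow> real) \<Rightarrow> bool" where
  "optimal_feedback xi sbar lam f r cm s \<longleftrightarrow>
     (\<forall>x\<le>xi. \<forall>t\<ge>0. optimal_rate xi sbar lam f r cm x t (s x t))"

definition bang_bang :: "nat \<Rightarrow> real \<Rightarrow> (nat \<Rightarrow> real \<Rightarrow> real) \<Rightarrow> bool" where
  "bang_bang xi sbar s \<longleftrightarrow> (\<forall>x\<le>xi. \<forall>t\<ge>0. s x t = 0 \<or> s x t = sbar)"

text \<open>Convexity on the integer points \<open>0, \<dots>, xi\<close>: the increments are increasing.\<close>

definition discrete_convex :: "nat \<Rightarrow> (nat \<Rightarrow> real) \<Rightarrow> bool" where
  "discrete_convex xi c \<longleftrightarrow> (\<forall>x. x + 2 \<le> xi \<longrightarrow> c (x + 1) - c x \<le> c (x + 2) - c (x + 1))"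

text \<open>
  The supremum in \<open>J_opt\<close> is that of a nonempty bounded set of reals, so it carries its usual meaning.
\<close>

lemma prob_space_exponential: "prob_space (density lborel (\<lambda>e. ennreal (exponential_density 1 e)))"
  by (rule prob_space_exponential_density) simp

lemma prob_space_noise: "prob_space noise"
  unfolding noise_def by (intro prob_space_PiM prob_space_exponential)

lemma AE_noise_pos: "AE \<omega> in noise. \<forall>n. 0 < \<omega> n"
proof -
  have "AE e in density lborel (\<lambda>e. ennreal (exponential_density 1 e)). 0 < e"
    using AE_lborel_singleton[of 0]
    by (auto simp: AE_density exponential_density_def)
  then have "AE \<omega> in noise. 0 < \<omega> n" for n
    unfolding noise_def
    by (intro AE_PiM_component[where P = "\<lambda>e. 0 < e"] prob_space_exponential) auto
  then show ?thesis by (simp add: AE_all_countable)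
qed

lemma idle_mem_policies:
  assumes "0 < sbar" and "f 0 = 0"
  shows "(\<lambda>h k. 0) \<in> policies xi sbar lam f"
proof -
  have jump: "next_jump lam f (\<lambda>h k. 0) h e = -1" if "0 < e" for h e
    using that assms(2) by (simp add: next_jump_def)
  have level: "level_at lam f (\<lambda>h k. 0) x t \<omega> k = x" if "\<forall>n. 0 < \<omega> n" "0 \<le> k" for x t \<omega> k
  proof -
    have "jumps_until lam f (\<lambda>h k. 0) x t \<omega> k = 0"
      using that by (simp add: jumps_until_def Let_def jump)
    then show ?thesis by (simp add: level_at_def hist_at_def)
  qed
  have "AE \<omega> in noise. \<forall>k\<in>{0..t}. level_at lam f (\<lambda>h k. 0) x t \<omega> k \<le> xi" if "x \<le> xi" for x t
    using AE_noise_pos by eventually_elim (use that level in auto)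
  then show ?thesis using assms(1) by (auto simp: policies_def)
qed

lemma J_bounded:
  assumes "0 < sbar" and "mono_on {0..sbar} r"
    and "mono_on {0..xi} cm" and "\<And>y. y \<le> xi \<Longrightarrow> 0 \<le> cm y"
    and "u \<in> policies xi sbar lam f" and "x \<le> xi" and "0 \<le> t"
  shows "\<bar>J lam f r cm u x t\<bar> \<le> t * (\<bar>r 0\<bar> + \<bar>r sbar\<bar>) + cm xi"
proof -
  interpret prob_space noise by (rule prob_space_noise)
  let ?B = "\<bar>r 0\<bar> + \<bar>r sbar\<bar>"
  let ?R = "\<lambda>\<omega>. LINT k:{0..t}|lborel. r (rate_at lam f u x t \<omega> k)"
  let ?F = "\<lambda>\<omega>. ?R \<omega> - cm (level_at lam f u x t \<omega> 0)"
  have B: "\<bar>r (rate_at lam f u x t \<omega> k)\<bar> \<le> ?B" for \<omega> k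
  proof -
    have s: "rate_at lam f u x t \<omega> k \<in> {0..sbar}"
      using assms(5) by (auto simp: policies_def rate_at_def)
    have "r 0 \<le> r (rate_at lam f u x t \<omega> k)" "r (rate_at lam f u x t \<omega> k) \<le> r sbar"
      using s assms(1) by (auto intro!: mono_onD[OF assms(2)])
    then show ?thesis by linarith
  qed
  have R: "\<bar>?R \<omega>\<bar> \<le> t * ?B" for \<omega>
  proof -
    let ?g = "\<lambda>k. indicator {0..t} k *\<^sub>R r (rate_at lam f u x t \<omega> k)"
    show ?thesis
    proof (cases "integrable lborel ?g")
      case True
      have G: "integrable lborel (\<lambda>k. indicator {0..t} k * ?B)"
        using assms(7) by (intro integrable_mult_left integrable_real_indicator) simp_all
      have "norm (integral\<^sup>L lborel ?g) \<le> (LINT k|lborel. indicator {0..t} k * ?B)"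
        by (rule Bochner_Integration.integral_norm_bound_integral[OF True G])
           (use B in \<open>simp add: indicator_def\<close>)
      then show ?thesis using assms(7) by (simp add: set_lebesgue_integral_def)
    next
      case False
      then show ?thesis
        using assms(7) by (simp add: set_lebesgue_integral_def not_integrable_integral_eq)
    qed
  qed
  have "AE \<omega> in noise. \<forall>k\<in>{0..t}. level_at lam f u x t \<omega> k \<le> xi"
    using assms(5-7) by (auto simp: policies_def)
  then have F: "AE \<omega> in noise. \<bar>?F \<omega>\<bar> \<le> t * ?B + cm xi"
  proof eventually_elim
    case (elim \<omega>)
    then have l: "level_at lam f u x t \<omega> 0 \<le> xi" using assms(7) by auto
    then have "0 \<le> cm (level_at lam f u x t \<omega> 0)" "cm (level_at lam f u x t \<omega> 0) \<le> cm xi"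
      using assms(4) by (auto intro!: mono_onD[OF assms(3)])
    then show ?case using R[of \<omega>] by linarith
  qed
  show ?thesis
  proof (cases "integrable noise ?F")
    case True
    have "\<bar>LINT \<omega>|noise. ?F \<omega>\<bar> \<le> (LINT \<omega>|noise. \<bar>?F \<omega>\<bar>)"
      by (rule integral_abs_bound)
    also have "\<dots> \<le> (LINT \<omega>|noise. t * ?B + cm xi)"
      using True F by (intro integral_mono_AE) auto
    finally show ?thesis by (simp add: J_def prob_space)
  next
    case False
    then show ?thesis
      using assms(4)[of xi] assms(7) by (simp add: J_def not_integrable_integral_eq)
  qed
qed

end

theory Submission
  imports Defs
begin

text \<open>
  The claim holds for \<open>r - c f\<close> with an arbitrary constant \<open>c\<close>, so nothing about the value function
  is used.  If \<open>c \<le> 0\<close>, the objective is increasing and \<open>sbar\<close> is optimal.  If \<open>c > 0\<close>, it is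
  \<open>(1 - c) f\<close> in case (i) and convex in case (iii).  In case (ii) it is
  \<open>s\<^sup>\<beta> (a s\<^bsup>\<alpha> - \<beta>\<^esup> - c b)\<close>, whose second factor is increasing if \<open>a \<ge> 0\<close>: either this factor is
  nonnegative at \<open>sbar\<close>, and then \<open>sbar\<close> is optimal, or it is negative throughout, and then \<open>0\<close> is.
  If \<open>a < 0 < b\<close>, monotonicity of \<open>r\<close> would force \<open>\<beta> \<le> \<alpha> \<le> 0\<close>, against \<open>f 0 = 0\<close> and continuity.
\<close>

text \<open>The power laws are given only on \<open>{0<..sbar}\<close>, because
  \<open>0 powr x\<close> is 0 even for exponent 0; continuity carries bounds from there to
  0.\<close>

lemma continuous_on_ge_left_endpoint:
  fixes g :: "real \<Rightarrow> real"
  assumes "continuous_on {a..b} g" and "a < b" and "\<And>s. s \<in> {a<..b} \<Longrightarrow> C \<le> g s"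
  shows "C \<le> g a"
proof -
  have "closure {a<..b} = {a..b}" using assms(2) by simp
  then show ?thesis
    using continuous_ge_on_closure[of "{a<..b}" g a C] assms by simp
qed

lemma powr_difference_max_at_endpoint:
  fixes f r :: "real \<Rightarrow> real"
  assumes b0: "0 < sbar" and c: "0 < c"
    and fc: "continuous_on {0..sbar} f" and fm: "mono_on {0..sbar} f" and f0: "f 0 = 0"
    and rc: "continuous_on {0..sbar} r" and rm: "mono_on {0..sbar} r" and r0: "r 0 \<le> 0"
    and ab: "\<beta> \<le> \<alpha>"
    and r: "\<And>s. s \<in> {0<..sbar} \<Longrightarrow> r s = a * s powr \<alpha>"
    and f: "\<And>s. s \<in> {0<..sbar} \<Longrightarrow> f s = b * s powr \<beta>"
  shows "\<exists>z\<in>{0, sbar}. \<forall>s\<in>{0..sbar}. r s - c * f s \<le> r z - c * f z"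
proof -
  have rle: "r s \<le> r sbar" and fle: "f s \<le> f sbar" if "s \<in> {0..sbar}" for s
    using that mono_onD[OF rm, of s sbar] mono_onD[OF fm, of s sbar] by auto
  have "0 \<le> b * sbar powr \<beta>" using f[of sbar] fle[of 0] f0 b0 by simp
  then have "0 \<le> b" using b0 by (simp add: zero_le_mult_iff)
  then consider "b = 0" | "0 < b" by linarith
  then show ?thesis
  proof cases
    case 1
    then have "f s = 0" if "s \<in> {0..sbar}" for s
      using that f[of s] f0 by (cases "s = 0") auto
    then show ?thesis using rle b0 by auto
  next
    case 2
    have a: "0 \<le> a"
    proof (rule ccontr)
      assume "\<not> 0 \<le> a"
      \<comment> \<open>Any interior point would do. Cancelling the negative \<open>a\<close>
        reverses the inequality, which rules out \<alpha> > 0.\<close>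
      moreover have "r (sbar / 2) \<le> r sbar" using b0 by (intro rle) auto
      ultimately have "sbar powr \<alpha> \<le> (sbar / 2) powr \<alpha>"
        using r[of "sbar / 2"] r[of sbar] b0 by simp
      then have "\<not> 0 < \<alpha>"
        using powr_less_mono2[of \<alpha> "sbar / 2" sbar] b0 by auto
      then have "\<beta> \<le> 0" using ab by simp
      \<comment> \<open>For \<beta> \<le> 0 the power is decreasing, so \<open>f\<close> stays above
        its positive value at \<open>sbar\<close>, and its limit at 0 cannot be 0.\<close>
      then have "b * sbar powr \<beta> \<le> f s" if "s \<in> {0<..sbar}" for s
        using that f[of s] 2 powr_mono2'[of \<beta> s sbar] by simp
      then have "b * sbar powr \<beta> \<le> f 0"
        by (rule continuous_on_ge_left_endpoint[OF fc b0])
      then show False using 2 b0 f0 by (simp add: mult_le_0_iff)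
    qed
    define q where "q s = a * s powr (\<alpha> - \<beta>) - c * b" for s
    have q_mono: "q s \<le> q sbar" if "s \<in> {0<..sbar}" for s
      using that a ab by (auto simp: q_def intro!: mult_left_mono powr_mono2)
    have obj: "r s - c * f s = s powr \<beta> * q s" if "s \<in> {0<..sbar}" for s
      using that r[of s] f[of s] powr_add[of s "\<alpha> - \<beta>" \<beta>] by (simp add: q_def algebra_simps)
    have obj_le: "r s - c * f s \<le> s powr \<beta> * q sbar" if "s \<in> {0<..sbar}" for s
      unfolding obj[OF that] using q_mono[OF that] by (intro mult_left_mono) auto
    show ?thesis
    proof (cases "0 \<le> q sbar")
      case True
      have "r s - c * f s \<le> r sbar - c * f sbar" if s: "s \<in> {0..sbar}" for s
      proof (cases "s = 0")
        case zero: True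
        \<comment> \<open>The factorization \<open>obj\<close> does not reach 0, so the signs are
          compared: the objective is \<open>r 0\<close> \<le> 0 at 0 and nonnegative at
          \<open>sbar\<close>.\<close>
        have "0 \<le> sbar powr \<beta> * q sbar" using True by simp
        then show ?thesis using obj[of sbar] b0 r0 f0 zero by simp
      next
        case False
        then have s': "s \<in> {0<..sbar}" using s by auto
        \<comment> \<open>The sign of \<beta> is not known here; the inequality is the monotonicity
          of \<open>f\<close> divided by \<open>b\<close> > 0.\<close>
        have "s powr \<beta> \<le> sbar powr \<beta>"
          using fle[OF s] f[OF s'] f[of sbar] b0 2 by simp
        then have "s powr \<beta> * q sbar \<le> sbar powr \<beta> * q sbar"
          using True by (intro mult_right_mono) auto
        then show ?thesis using obj_le[OF s'] obj[of sbar] b0 by simp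
      qed
      then show ?thesis by auto
    next
      case False
      \<comment> \<open>The objective at 0 is \<open>r 0\<close>, for which only an upper bound is
        assumed. Since \<open>a\<close> \<ge> 0, \<open>r\<close> is nonnegative away from 0, hence
        also at 0.\<close>
      have r0_ge: "0 \<le> r 0"
        using a r by (intro continuous_on_ge_left_endpoint[OF rc b0]) auto
      have nonpos: "r s - c * f s \<le> 0" if s: "s \<in> {0<..sbar}" for s
      proof -
        have "s powr \<beta> * q sbar \<le> 0"
          using False by (intro mult_nonneg_nonpos) auto
        then show ?thesis using obj_le[OF s] by linarith
      qed
      have "r s - c * f s \<le> r 0 - c * f 0" if "s \<in> {0<..sbar}" for s
        using nonpos[OF that] r0_ge f0 by simp
      then have "r s - c * f s \<le> r 0 - c * f 0" if "s \<in> {0..sbar}" for s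
        using that by (cases "s = 0") auto
      then show ?thesis by auto
    qed
  qed
qed

text \<open>Here \<open>c\<close> stands for \<open>lam\<close> times \<open>Delta\<close> at a
  fixed state, so either sign is allowed.\<close>

lemma difference_max_at_endpoint:
  fixes f r :: "real \<Rightarrow> real"
  assumes b0: "0 < sbar"
    and fc: "continuous_on {0..sbar} f" and fm: "mono_on {0..sbar} f" and f0: "f 0 = 0"
    and rc: "continuous_on {0..sbar} r" and rm: "mono_on {0..sbar} r" and r0: "r 0 \<le> 0"
    and cases: "(\<forall>s\<in>{0..sbar}. r s = f s)
         \<or> (\<exists>\<alpha> \<beta> a b. \<alpha> \<ge> \<beta> \<and> (\<forall>s\<in>{0<..sbar}. r s = a * s powr \<alpha> \<and> f s = b * s powr \<beta>))
         \<or> (convex_on {0..sbar} r \<and> concave_on {0..sbar} f)"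
  shows "\<exists>z\<in>{0, sbar}. \<forall>s\<in>{0..sbar}. r s - c * f s \<le> r z - c * f z"
proof (cases "c \<le> 0")
  case True
  have "r s - c * f s \<le> r sbar - c * f sbar" if "s \<in> {0..sbar}" for s
  proof -
    have "r s \<le> r sbar" "f s \<le> f sbar"
      using that mono_onD[OF rm, of s sbar] mono_onD[OF fm, of s sbar] by auto
    then show ?thesis using True by (intro diff_mono mult_left_mono_neg)
  qed
  then show ?thesis by auto
next
  case False
  then have c: "0 < c" by simp
  from cases consider
    (same) "\<forall>s\<in>{0..sbar}. r s = f s"
    | (pow) \<alpha> \<beta> a b where "\<alpha> \<ge> \<beta>"
        "\<And>s. s \<in> {0<..sbar} \<Longrightarrow> r s = a * s powr \<alpha>" "\<And>s. s \<in> {0<..sbar} \<Longrightarrow> f s = b * s powr \<beta>"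
    | (conv) "convex_on {0..sbar} r" "concave_on {0..sbar} f"
    by blast
  then show ?thesis
  proof cases
    case same
    have f_bounds: "0 \<le> f s" "f s \<le> f sbar" if "s \<in> {0..sbar}" for s
      using that f0 mono_onD[OF fm, of 0 s] mono_onD[OF fm, of s sbar] by auto
    have obj: "r s - c * f s = (1 - c) * f s" if "s \<in> {0..sbar}" for s
      using same that by (simp add: algebra_simps)
    show ?thesis
    \<comment> \<open>The sign of \<open>1 - c\<close> decides whether the largest or the smallest
      value of \<open>f\<close> is wanted; by monotonicity these are taken at \<open>sbar\<close>
      and at 0.\<close>
    proof (cases "c \<le> 1")
      case True
      then have "r s - c * f s \<le> r sbar - c * f sbar" if "s \<in> {0..sbar}" for s
        using that f_bounds[OF that] obj[of s] obj[of sbar] b0 by (simp add: mult_left_mono)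
      then show ?thesis by auto
    next
      case False
      then have "r s - c * f s \<le> r 0 - c * f 0" if "s \<in> {0..sbar}" for s
        using that f_bounds[OF that] obj[of s] obj[of 0] b0 f0 by (simp add: mult_nonpos_nonneg)
      then show ?thesis by auto
    qed
  next
    case pow
    then show ?thesis
      by (intro powr_difference_max_at_endpoint[OF b0 c fc fm f0 rc rm r0])
  next
    case conv
    \<comment> \<open>Positivity of \<open>c\<close> keeps the second summand convex, and a convex
      function on an interval is bounded by its larger endpoint value.\<close>
    have "convex_on {0..sbar} (\<lambda>s. r s + c * (- f s))"
      using conv c by (intro convex_on_add convex_on_cmul) (auto simp: concave_on_def)
    then have "r s - c * f s \<le> max (r 0 - c * f 0) (r sbar - c * f sbar)" if "s \<in> {0..sbar}" for s
      using that convex_on_le_max[of 0 sbar "\<lambda>s. r s + c * (- f s)" s] b0 by simp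
    then show ?thesis
      by (cases "r 0 - c * f 0 \<le> r sbar - c * f sbar") (auto simp: max_def)
  qed
qed

theorem corollary1:
  fixes xi :: nat and sbar lam :: real and f r :: "real \<Rightarrow> real" and cm :: "nat \<Rightarrow> real"
  assumes "0 < sbar" and "0 \<le> lam"
    and "continuous_on {0..sbar} f" and "mono_on {0..sbar} f"
    and "\<And>s. s \<in> {0..sbar} \<Longrightarrow> 0 \<le> f s" and "f 0 = 0"
    and "continuous_on {0..sbar} r" and "mono_on {0..sbar} r" and "r 0 \<le> 0"
    and "\<And>x. x \<le> xi \<Longrightarrow> 0 \<le> cm x" and "mono_on {0..xi} cm" and "discrete_convex xi cm"
    and "(\<forall>s\<in>{0..sbar}. r s = f s)
         \<or> (\<exists>\<alpha> \<beta> a b. \<alpha> \<ge> \<beta> \<and> (\<forall>s\<in>{0<..sbar}. r s = a * s powr \<alpha> \<and> f s = b * s powr \<beta>))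
         \<or> (convex_on {0..sbar} r \<and> concave_on {0..sbar} f)"
  shows "\<exists>s. bang_bang xi sbar s \<and> optimal_feedback xi sbar lam f r cm s"
proof -
  let ?g = "\<lambda>x t s. r s - lam * f s * Delta xi sbar lam f r cm x t"
  have "\<exists>z\<in>{0, sbar}. \<forall>s\<in>{0..sbar}. ?g x t s \<le> ?g x t z" for x t
    using difference_max_at_endpoint[OF assms(1,3,4,6,7,8,9,13),
        of "lam * Delta xi sbar lam f r cm x t"]
    by (simp add: mult_ac)
  then obtain z where z: "\<And>x t. z x t \<in> {0, sbar}"
    "\<And>x t s. s \<in> {0..sbar} \<Longrightarrow> ?g x t s \<le> ?g x t (z x t)"
    by metis
  have z_range: "z x t \<in> {0..sbar}" for x t
    using z(1)[of x t] assms(1) by auto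
  have "is_arg_max (?g x t) (\<lambda>s. s \<in> {0..sbar}) (z x t)" for x t
    using z(2) z_range by (auto simp: is_arg_max_linorder)
  \<comment> \<open>At the failure level \<open>optimal_rate\<close> demands 0 instead of a
    maximizer, so \<open>z\<close> is overridden there; 0 is still a bang-bang value.\<close>
  then have "optimal_feedback xi sbar lam f r cm (\<lambda>x t. if x < xi then z x t else 0)"
    by (simp add: optimal_feedback_def optimal_rate_def)
  moreover have "bang_bang xi sbar (\<lambda>x t. if x < xi then z x t else 0)"
    using z(1) by (auto simp: bang_bang_def)
  ultimately show ?thesis by blast
qed

end
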